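(* Let $f\in\mathbb{R}[\boldsymbol{x}]$, $\boldsymbol{x}=(x_1,\ldots,x_n)$, let $G(\boldsymbol{x})$ be a $q\times q$ symmetric real polynomial matrix, $\mathbf{K}=\{\boldsymbol{x}\in\mathbb{R}^n\mid G(\boldsymbol{x})\succeq0\}$, $f^{\star}=\min_{\boldsymbol{x}\in\mathbf{K}}f(\boldsymbol{x})$, and let $\boldsymbol{u}^{\star}\in\mathbf{K}$ be a minimizer of $f$ over $\mathbf{K}$. Let $G(\boldsymbol{x})$ be linear (resp., nonlinear with $I_q-G(\boldsymbol{x})\succeq0$ on $\mathbf{K}$). For $m\in\mathbb{N}$ let $f^{\star}_m=\sup\{r\in\mathbb{R}\mid f(\boldsymbol{x})-r\in\mathcal{H}_m(G)\}$. If there exists a nonoptimal point $\boldsymbol{u}\in\mathbf{K}$ (i.e. $f(\boldsymbol{u})>f^{\star}$) such that $\mathrm{Null}(G(\boldsymbol{u}^{\star}))\subseteq\mathrm{Null}(G(\boldsymbol{u}))$ (resp., $\mathrm{Null}(\widetilde{G}(\boldsymbol{u}^{\star}))\subseteq\mathrm{Null}(\widetilde{G}(\boldsymbol{u}))$), then no relaxation is exact, i.e. $f^{\star}_m\neq f^{\star}$ for every $m\in\mathbb{N}$. In particular, if $G(\boldsymbol{u}^{\star})\succ0$ (resp., $G(\boldsymbol{u}^{\star})\succ0$ and $I_q-G(\boldsymbol{u}^{\star})\succ0$), then no relaxation is exact.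
   Context: $\mathbb{N}$ is the set of nonnegative integers; $\mathbb{R}_+$ the nonnegative reals; $[m]=\{1,\ldots,m\}$; $I_q$ is the $q\times q$ identity matrix; $\mathbb{S}^{p}_+$ is the set of $p\times p$ real symmetric positive semidefinite matrices; $\succeq0$ (resp. $\succ0$) means positive semidefinite (resp. positive definite); $\langle A,B\rangle=\mathrm{tr}(A^{\intercal}B)$; $U^{\otimes k}$ is the $k$-fold Kronecker power; $\mathrm{Null}(A)$ is the null space of $A$. "Linear" means $G(\boldsymbol{x})=A_0+\sum_{i=1}^nA_ix_i$ with real symmetric $A_i$. $\widetilde{G}(\boldsymbol{x})=\mathrm{diag}(G(\boldsymbol{x}),I_q-G(\boldsymbol{x}))$. For $m\in\mathbb{N}$: if $G$ is linear, $\mathcal{H}_m(G):=\{\lambda_0+\sum_{k=1}^m\langle\Lambda_k,G(\boldsymbol{x})^{\otimes k}\rangle\mid\lambda_0\in\mathbb{R}_+,\ \Lambda_k\in\mathbb{S}^{q^k}_+,\ k\in[m]\}$; if $G$ is nonlinear, $\mathcal{H}_m(G):=\{\lambda_0+\sum_{k=1}^m\langle\Lambda_k,\widetilde{G}(\boldsymbol{x})^{\otimes k}\rangle\mid\lambda_0\in\mathbb{R}_+,\ \Lambda_k\in\mathbb{S}^{(2q)^k}_+,\ k\in[m]\}$. The supremum of the empty set is $-\infty$.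
   Formalization: In the "in particular" claim, f is additionally assumed not to be a constant polynomial; for constant f = c one has f − c = 0 in H_m(G), so every relaxation is exact and the claim fails as written. *)

theory Defs
  imports
    "HOL-Analysis.Finite_Cartesian_Product"
    "HOL-Library.Poly_Mapping"
    "HOL-Library.Extended_Real"
    "Jordan_Normal_Form.Matrix_Kernel"
begin

section \<open>Real polynomials in finitely many variables\<close>

text \<open>
  The polynomial ring \<open>\<real>[x]\<close> is the monoid algebra of the monoid of exponent vectors, with the
  convolution product of \<^theory>\<open>HOL-Library.Poly_Mapping\<close>. The variables are indexed by the
  finite type \<^typ>\<open>'n\<close>, which also indexes the coordinates of points.
\<close>

type_synonym 'n rpoly = "('n \<Rightarrow>\<^sub>0 nat) \<Rightarrow>\<^sub>0 real"

definition Const :: "real \<Rightarrow> 'n rpoly" where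
  "Const c = Poly_Mapping.single 0 c"

definition Var :: "'n \<Rightarrow> 'n rpoly" where
  "Var i = Poly_Mapping.single (Poly_Mapping.single i 1) 1"

definition peval :: "'n::finite rpoly \<Rightarrow> real ^ 'n \<Rightarrow> real" where
  "peval p x = (\<Sum>\<alpha>\<in>Poly_Mapping.keys p. Poly_Mapping.lookup p \<alpha> * 
     (\<Prod>i\<in>UNIV. vec_nth x i ^ Poly_Mapping.lookup \<alpha> i))"

section \<open>Matrices\<close>

definition sym_mat :: "nat \<Rightarrow> 'a mat \<Rightarrow> bool" where
  "sym_mat p A \<longleftrightarrow> A \<in> carrier_mat p p \<and> transpose_mat A = A"

definition psd :: "nat \<Rightarrow> real mat \<Rightarrow> bool" where
  "psd p A \<longleftrightarrow> sym_mat p A \<and> (\<forall>v\<in>carrier_vec p. v \<bullet> (A *\<^sub>v v) \<ge> 0)"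

definition pd :: "nat \<Rightarrow> real mat \<Rightarrow> bool" where
  "pd p A \<longleftrightarrow> sym_mat p A \<and> (\<forall>v\<in>carrier_vec p. v \<noteq> 0\<^sub>v p \<longrightarrow> v \<bullet> (A *\<^sub>v v) > 0)"

definition mat_inner :: "'a::comm_ring_1 mat \<Rightarrow> 'a mat \<Rightarrow> 'a" where
  "mat_inner A B = (\<Sum>i<dim_col A. (transpose_mat A * B) $$ (i, i))"

definition kron :: "'a::times mat \<Rightarrow> 'a mat \<Rightarrow> 'a mat" where
  "kron A B = mat (dim_row A * dim_row B) (dim_col A * dim_col B)
     (\<lambda>(i, j). A $$ (i div dim_row B, j div dim_col B) * B $$ (i mod dim_row B, j mod dim_col B))"

primrec kron_pow :: "'a::comm_ring_1 mat \<Rightarrow> nat \<Rightarrow> 'a mat" where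
  "kron_pow A 0 = 1\<^sub>m 1"
| "kron_pow A (Suc k) = kron A (kron_pow A k)"

section \<open>Polynomial matrices and the hierarchy\<close>

definition eval_mat :: "'n::finite rpoly mat \<Rightarrow> real ^ 'n \<Rightarrow> real mat" where
  "eval_mat G x = map_mat (\<lambda>p. peval p x) G"

text \<open>Linearity allows a constant term, i.e. it means affine dependence on the variables.\<close>

definition linear_pmat :: "nat \<Rightarrow> 'n::finite rpoly mat \<Rightarrow> bool" where
  "linear_pmat q G \<longleftrightarrow> (\<exists>A0 A. sym_mat q A0 \<and> (\<forall>i. sym_mat q (A i)) \<and>
     G = mat q q (\<lambda>(j, k). Const (A0 $$ (j, k)) + (\<Sum>i\<in>UNIV. Const (A i $$ (j, k)) * Var i)))"

definition tilde :: "nat \<Rightarrow> 'n::finite rpoly mat \<Rightarrow> 'n rpoly mat" where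
  "tilde q G = four_block_mat G (0\<^sub>m q q) (0\<^sub>m q q) (1\<^sub>m q - G)"

definition feasible :: "nat \<Rightarrow> 'n::finite rpoly mat \<Rightarrow> (real ^ 'n) set" where
  "feasible q G = {x. psd q (eval_mat G x)}"

definition kron_cone :: "nat \<Rightarrow> nat \<Rightarrow> 'n::finite rpoly mat \<Rightarrow> 'n rpoly set" where
  "kron_cone m p M =
     {Const l0 + (\<Sum>k\<in>{1..m}. mat_inner (map_mat Const (L k)) (kron_pow M k)) | l0 L.
        l0 \<ge> 0 \<and> (\<forall>k\<in>{1..m}. psd (p ^ k) (L k))}"

definition hierarchy :: "nat \<Rightarrow> nat \<Rightarrow> 'n::finite rpoly mat \<Rightarrow> 'n rpoly set" where
  "hierarchy q m G =
     (if linear_pmat q G then kron_cone m q G else kron_cone m (2 * q) (tilde q G))"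

text \<open>Both values are extended reals, so that the supremum of the empty set is \<open>-\<infinity>\<close>.\<close>

definition opt_value :: "nat \<Rightarrow> 'n::finite rpoly \<Rightarrow> 'n rpoly mat \<Rightarrow> ereal" where
  "opt_value q f G = (INF x\<in>feasible q G. ereal (peval f x))"

definition relax_value :: "nat \<Rightarrow> nat \<Rightarrow> 'n::finite rpoly \<Rightarrow> 'n rpoly mat \<Rightarrow> ereal" where
  "relax_value q m f G = (SUP r\<in>{r. f - Const r \<in> hierarchy q m G}. ereal r)"

end

theory Submission
  imports Defs
begin

text \<open>
  Let \<open>A\<close> and \<open>B\<close> be the values at \<open>u\<^sup>\<star>\<close> and at
  \<open>u\<close> of the matrix whose Kronecker powers generate the hierarchy. Both are positive
  semidefinite, in the nonlinear case because \<open>I - G\<close> is so on the feasible set, and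
  the inclusion of their null spaces gives a constant \<open>C \<ge> 1\<close> such that
  \<open>C A - B\<close> is positive semidefinite
  (\<open>psd_dominated_if_kernel_subset\<close>). The order is compatible with Kronecker powers
  (\<open>psd_kron_pow_mono\<close>) and with the inner product against a positive semidefinite
  matrix (\<open>mat_inner_psd_nonneg\<close>). Hence every \<open>h\<close> in the cone of level
  \<open>m\<close> satisfies \<open>h(u) \<le> C\<^sup>m h(u\<^sup>\<star>)\<close>, with a
  factor that does not depend on \<open>h\<close> (\<open>kron_cone_growth\<close>). For
  \<open>h = f - r\<close> this reads
  \<open>f(u) - r \<le> C\<^sup>m (f\<^sup>\<star> - r)\<close>. Since
  \<open>f(u) > f\<^sup>\<star>\<close>, the number \<open>f\<^sup>\<star> - r\<close> is at
  least \<open>(f(u) - f\<^sup>\<star>) / C\<^sup>m\<close>, so \<open>r\<close> stays away from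
  \<open>f\<^sup>\<star>\<close> and the supremum is strictly smaller.

  If the matrix at \<open>u\<^sup>\<star>\<close> is positive definite, its null space is trivial
  and the inclusion holds for every \<open>u\<close>. What remains is to find a feasible point that
  is not optimal. As \<open>u\<^sup>\<star>\<close> is an interior point of the feasible set, the
  absence of such a point would make the polynomial \<open>f\<close> constant near
  \<open>u\<^sup>\<star>\<close>, and therefore constant (\<open>poly_eq_zero_if_zero_near\<close>).
\<close>

section \<open>Positive semidefinite matrices\<close>

text \<open>
  Evaluate the quadratic at its vertex; if \<open>a = 0\<close>, an affine function that is
  nonnegative on the whole line has slope zero.
\<close>

lemma quadratic_nonneg_discriminant:
  fixes a b c :: real
  assumes "\<And>x. 0 \<le> a * x\<^sup>2 + 2 * b * x + c" and "0 \<le> a"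
  shows "b\<^sup>2 \<le> a * c"
proof (cases "a = 0")
  case True
  have "b = 0"
  proof (rule ccontr)
    assume "b \<noteq> 0"
    \<comment> \<open>At this point the affine function \<open>2 * b * x + c\<close> takes the value \<open>-1\<close>.\<close>
    then show False
      using assms(1)[of "- (c + 1) / (2 * b)"] True by simp
  qed
  then show ?thesis
    using True by simp
next
  case False
  then have a: "0 < a"
    using assms(2) by simp
  have "0 \<le> a * (a * (- b / a)\<^sup>2 + 2 * b * (- b / a) + c)"
    using assms(1)[of "- b / a"] a by (intro mult_nonneg_nonneg) auto
  also have "\<dots> = a * c - b\<^sup>2"
    using a by (simp add: field_simps power2_eq_square)
  finally show ?thesis
    by simp
qed

text \<open>
  Symmetric elimination, one index \<open>s\<close> at a time: subtracting the rank-one matrix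
  \<open>A i s * A j s / A s s\<close> clears row and column \<open>s\<close> and leaves a
  positive semidefinite Schur complement, by the discriminant inequality for the form as a quadratic
  polynomial in the coordinate \<open>s\<close>. The subtracted matrix contributes one more vector
  \<open>l\<close>. If the pivot is zero, so are its row and column, and division by zero yielding
  zero lets the same formulas cover this case.
\<close>

lemma gram_decomposition:
  fixes A :: "'i \<Rightarrow> 'i \<Rightarrow> real"
  assumes "finite S"
    and "\<And>i j. i \<in> S \<Longrightarrow> j \<in> S \<Longrightarrow> A i j = A j i"
    and "\<And>w. 0 \<le> (\<Sum>i\<in>S. \<Sum>j\<in>S. A i j * w i * w j)"
  shows "\<exists>(N::nat) l. \<forall>i\<in>S. \<forall>j\<in>S. A i j = (\<Sum>t<N. l t i * l t j)"
  using assms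
proof (induction S arbitrary: A rule: finite_induct)
  case empty
  then show ?case by simp
next
  case (insert s S)
  define a where "a = A s s"
  define L where "L w = (\<Sum>j\<in>S. A j s * w j)" for w
  define Q where "Q w = (\<Sum>i\<in>S. \<Sum>j\<in>S. A i j * w i * w j)" for w
  have form: "0 \<le> a * x\<^sup>2 + 2 * L w * x + Q w" for w x
  proof -
    let ?w = "w(s := x)"
    have eq: "(\<Sum>j\<in>S. A i j * ?w i * ?w j) = (\<Sum>j\<in>S. A i j * ?w i * w j)" for i
      using insert.hyps by (intro sum.cong) auto
    have "(\<Sum>i\<in>insert s S. \<Sum>j\<in>insert s S. A i j * ?w i * ?w j)
        = a * x\<^sup>2 + (\<Sum>j\<in>S. A s j * x * w j) + (\<Sum>i\<in>S. A i s * ?w i * x)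
          + (\<Sum>i\<in>S. \<Sum>j\<in>S. A i j * ?w i * w j)"
      using insert.hyps by (simp add: eq sum.distrib a_def power2_eq_square fun_upd_same del: fun_upd_apply)
    also have "(\<Sum>j\<in>S. A s j * x * w j) = L w * x"
      unfolding L_def sum_distrib_right
      using insert.prems(1) by (intro sum.cong) auto
    also have "(\<Sum>i\<in>S. A i s * ?w i * x) = L w * x"
      unfolding L_def sum_distrib_right
      using insert.hyps by (intro sum.cong) auto
    also have "(\<Sum>i\<in>S. \<Sum>j\<in>S. A i j * ?w i * w j) = Q w"
      unfolding Q_def using insert.hyps by (intro sum.cong) auto
    finally show ?thesis
      using insert.prems(2)[of ?w] by (simp only: mult.assoc mult_2 distrib_right)
  qed
  have a: "0 \<le> a"
    using form[of 1 "\<lambda>_. 0"] by (simp add: L_def Q_def)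
  have disc: "(L w)\<^sup>2 \<le> a * Q w" for w
    using quadratic_nonneg_discriminant[OF form a] .
  have column: "A i s = 0" if "a = 0" "i \<in> S" for i
  proof -
    have "L (\<lambda>j. if j = i then 1 else 0) = A i s"
      unfolding L_def using that insert.hyps by (simp add: if_distrib cong: if_cong)
    then show ?thesis
      using disc[of "\<lambda>j. if j = i then 1 else 0"] that by simp
  qed
  define B where "B i j = A i j - A i s * A j s / a" for i j
  have "\<exists>(N::nat) l. \<forall>i\<in>S. \<forall>j\<in>S. B i j = (\<Sum>t<N. l t i * l t j)"
  proof (rule insert.IH)
    show "B i j = B j i" if "i \<in> S" "j \<in> S" for i j
      using that insert.prems(1) by (simp add: B_def mult.commute)
    fix w
    have "(\<Sum>i\<in>S. \<Sum>j\<in>S. B i j * w i * w j)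
        = Q w - (\<Sum>i\<in>S. \<Sum>j\<in>S. (A i s * w i) * (A j s * w j) / a)"
      unfolding Q_def sum_subtractf[symmetric]
      by (intro sum.cong) (auto simp: B_def algebra_simps)
    also have "(\<Sum>i\<in>S. \<Sum>j\<in>S. (A i s * w i) * (A j s * w j) / a) = (L w)\<^sup>2 / a"
      by (simp add: L_def power2_eq_square sum_product sum_divide_distrib)
    also have "0 \<le> Q w - (L w)\<^sup>2 / a"
    proof (cases "a = 0")
      case True
      then show ?thesis
        using form[where x = 0] by simp
    next
      case False
      then show ?thesis
        using a disc[of w] by (simp add: field_simps)
    qed
    finally show "0 \<le> (\<Sum>i\<in>S. \<Sum>j\<in>S. B i j * w i * w j)" .
  qed
  then obtain N :: nat and l where
    l: "\<And>i j. i \<in> S \<Longrightarrow> j \<in> S \<Longrightarrow> B i j = (\<Sum>t<N. l t i * l t j)"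
    by blast
  \<comment> \<open>The old vectors are extended by zero at \<open>s\<close>, and the new vector \<open>l' N\<close> restores what was subtracted.\<close>
  define l' where "l' t i = (if t < N then if i = s then 0 else l t i else A i s / sqrt a)" for t i
  have last: "l' N i * l' N j = A i s * A j s / a" for i j
    using a by (simp add: l'_def)
  have "A i j = (\<Sum>t<Suc N. l' t i * l' t j)" if "i \<in> insert s S" "j \<in> insert s S" for i j
  proof (cases "i = s \<or> j = s")
    case True
    have "(\<Sum>t<N. l' t i * l' t j) = 0"
      using True by (intro sum.neutral) (auto simp: l'_def)
    moreover have "A i s * A j s / a = A i j"
      using True that column insert.prems(1)[of i j] by (cases "a = 0") (auto simp: a_def)
    ultimately show ?thesis
      using last by simp
  next
    case False
    then have "(\<Sum>t<N. l' t i * l' t j) = B i j"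
      using that by (subst l) (auto simp: l'_def intro!: sum.cong)
    then show ?thesis
      using last by (simp add: B_def)
  qed
  then show ?case
    by (intro exI[of _ "Suc N"] exI[of _ l']) blast
qed

text \<open>
  A functional that vanishes on the common kernel of finitely many functionals is a linear
  combination of them, whence the bound. Only the bound is carried through the induction on their
  number. Either the last functional already vanishes on the common kernel of the others and can be
  ignored, or some \<open>w0\<close> in that kernel lies outside its kernel, and subtracting a
  multiple of the last functional makes \<open>b\<close> vanish at \<open>w0\<close>, hence on the
  whole common kernel of the others.
\<close>

lemma functional_bounded_by_sum_of_squares:
  fixes l :: "nat \<Rightarrow> 'i \<Rightarrow> real" and b :: "'i \<Rightarrow> real"
  assumes "\<And>w. (\<forall>t<N. (\<Sum>i\<in>S. l t i * w i) = 0) \<Longrightarrow> (\<Sum>i\<in>S. b i * w i) = 0"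
  shows "\<exists>C\<ge>0. \<forall>w. (\<Sum>i\<in>S. b i * w i)\<^sup>2 \<le> C * (\<Sum>t<N. (\<Sum>i\<in>S. l t i * w i)\<^sup>2)"
  using assms
proof (induction N arbitrary: b)
  case 0
  then show ?case by (intro exI[of _ 0]) simp
next
  case (Suc N)
  let ?sq = "\<lambda>N w. \<Sum>t<N. (\<Sum>i\<in>S. l t i * w i)\<^sup>2"
  have sq: "0 \<le> ?sq N w" for w
    by (intro sum_nonneg) simp
  show ?case
  proof (cases "\<forall>w. (\<forall>t<N. (\<Sum>i\<in>S. l t i * w i) = 0) \<longrightarrow> (\<Sum>i\<in>S. l N i * w i) = 0")
    case True
    then have "(\<Sum>i\<in>S. b i * w i) = 0" if "\<forall>t<N. (\<Sum>i\<in>S. l t i * w i) = 0" for w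
      using that Suc.prems[of w] by (auto simp: less_Suc_eq)
    then obtain C where C: "C \<ge> 0" "\<And>w. (\<Sum>i\<in>S. b i * w i)\<^sup>2 \<le> C * ?sq N w"
      using Suc.IH[of b] by blast
    have "(\<Sum>i\<in>S. b i * w i)\<^sup>2 \<le> C * ?sq (Suc N) w" for w
      using C(2)[of w] C(1) by (simp add: algebra_simps add_increasing)
    then show ?thesis
      using C(1) by blast
  next
    case False
    then obtain w0 where w0: "\<And>t. t < N \<Longrightarrow> (\<Sum>i\<in>S. l t i * w0 i) = 0"
      and nz: "(\<Sum>i\<in>S. l N i * w0 i) \<noteq> 0"
      by blast
    \<comment> \<open>Chosen so that \<open>b'\<close> below is zero at \<open>w0\<close>.\<close>
    define d where "d = (\<Sum>i\<in>S. b i * w0 i) / (\<Sum>i\<in>S. l N i * w0 i)"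
    define b' where "b' i = b i - d * l N i" for i
    have b': "(\<Sum>i\<in>S. b' i * w i) = (\<Sum>i\<in>S. b i * w i) - d * (\<Sum>i\<in>S. l N i * w i)" for w
      by (simp add: b'_def sum_subtractf sum_distrib_left algebra_simps)
    have "(\<Sum>i\<in>S. b' i * w i) = 0" if w: "\<forall>t<N. (\<Sum>i\<in>S. l t i * w i) = 0" for w
    proof -
      \<comment> \<open>Moving \<open>w\<close> along \<open>w0\<close> brings it into the kernel of \<open>l N\<close> and preserves the values of \<open>l t\<close> for \<open>t < N\<close> and of \<open>b'\<close>.\<close>
      define c where "c = (\<Sum>i\<in>S. l N i * w i) / (\<Sum>i\<in>S. l N i * w0 i)"
      have split: "(\<Sum>i\<in>S. k i * (w i - c * w0 i)) = (\<Sum>i\<in>S. k i * w i) - c * (\<Sum>i\<in>S. k i * w0 i)"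
        for k :: "'i \<Rightarrow> real"
        by (simp add: sum_subtractf sum_distrib_left algebra_simps)
      have "\<forall>t<Suc N. (\<Sum>i\<in>S. l t i * (w i - c * w0 i)) = 0"
        unfolding split using w w0 nz by (auto simp: less_Suc_eq c_def)
      then have "(\<Sum>i\<in>S. b i * (w i - c * w0 i)) = 0"
        by (rule Suc.prems)
      then show ?thesis
        unfolding b' split by (simp add: c_def d_def)
    qed
    then obtain C where C: "C \<ge> 0" "\<And>w. (\<Sum>i\<in>S. b' i * w i)\<^sup>2 \<le> C * ?sq N w"
      using Suc.IH[of b'] by blast
    have "(\<Sum>i\<in>S. b i * w i)\<^sup>2 \<le> (2 * C + 2 * d\<^sup>2) * ?sq (Suc N) w" for w
    proof -
      let ?x = "\<Sum>i\<in>S. b' i * w i" and ?y = "\<Sum>i\<in>S. l N i * w i"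
      have "(\<Sum>i\<in>S. b i * w i)\<^sup>2 = (?x + d * ?y)\<^sup>2"
        using b' by simp
      also have "\<dots> \<le> 2 * ?x\<^sup>2 + 2 * d\<^sup>2 * ?y\<^sup>2"
        using zero_le_power2[of "?x - d * ?y"] by (simp add: power2_eq_square algebra_simps)
      also have "\<dots> \<le> 2 * (C * ?sq N w) + 2 * d\<^sup>2 * ?y\<^sup>2"
        using C(2)[of w] by simp
      also have "\<dots> \<le> (2 * C + 2 * d\<^sup>2) * (?sq N w + ?y\<^sup>2)"
        using C(1) sq[of w] by (simp add: distrib_left distrib_right)
      finally show ?thesis
        by simp
    qed
    then show ?thesis
      using C(1) by (intro exI[of _ "2 * C + 2 * d\<^sup>2"]) simp
  qed
qed

text \<open>
  The argument is a function rather than a vector, so that the statements on finite sums apply to it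
  directly.
\<close>

definition quad_form :: "nat \<Rightarrow> real mat \<Rightarrow> (nat \<Rightarrow> real) \<Rightarrow> real" where
  "quad_form p A w = (\<Sum>i<p. \<Sum>j<p. A $$ (i, j) * w i * w j)"

lemma mult_mat_vec_vec_index:
  assumes "A \<in> carrier_mat p p" "i < p"
  shows "(A *\<^sub>v vec p w) $ i = (\<Sum>j<p. A $$ (i, j) * w j)"
  using assms by (auto simp: scalar_prod_def atLeast0LessThan intro!: sum.cong)

lemma scalar_prod_mult_mat_vec:
  assumes "A \<in> carrier_mat p p"
  shows "vec p w \<bullet> (A *\<^sub>v vec p w) = quad_form p A w"
proof -
  have "vec p w \<bullet> (A *\<^sub>v vec p w) = (\<Sum>i<p. w i * (A *\<^sub>v vec p w) $ i)"
    unfolding scalar_prod_def atLeast0LessThan using assms by (intro sum.cong) auto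
  also have "\<dots> = quad_form p A w"
    using assms by (auto simp: mult_mat_vec_vec_index quad_form_def sum_distrib_left
        simp del: index_mult_mat_vec intro!: sum.cong)
  finally show ?thesis .
qed

lemma vec_of_index: "v \<in> carrier_vec p \<Longrightarrow> vec p (($) v) = v"
  by auto

lemma sym_mat_iff:
  "sym_mat p A \<longleftrightarrow> A \<in> carrier_mat p p \<and> (\<forall>i<p. \<forall>j<p. A $$ (i, j) = A $$ (j, i))"
  unfolding sym_mat_def by (auto simp: mat_eq_iff)

lemma psd_iff_quad_form:
  "psd p A \<longleftrightarrow> sym_mat p A \<and> (\<forall>w. 0 \<le> quad_form p A w)"
proof (cases "A \<in> carrier_mat p p")
  case True
  then show ?thesis
    unfolding psd_def
    by (metis scalar_prod_mult_mat_vec vec_of_index vec_carrier)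
qed (auto simp: psd_def sym_mat_def)

lemma psd_carrier: "psd p A \<Longrightarrow> A \<in> carrier_mat p p"
  by (simp add: psd_def sym_mat_def)

lemma psd_sym: "psd p A \<Longrightarrow> sym_mat p A"
  by (simp add: psd_def)

lemma quad_form_nonneg: "psd p A \<Longrightarrow> 0 \<le> quad_form p A w"
  by (simp add: psd_iff_quad_form)

lemma quad_form_gram:
  assumes "\<And>i j. i < p \<Longrightarrow> j < p \<Longrightarrow> A $$ (i, j) = (\<Sum>t\<in>T. l t i * l t j)"
  shows "quad_form p A w = (\<Sum>t\<in>T. (\<Sum>i<p. l t i * w i)\<^sup>2)"
proof -
  have "quad_form p A w = (\<Sum>i<p. \<Sum>j<p. \<Sum>t\<in>T. (l t i * w i) * (l t j * w j))"
    unfolding quad_form_def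
    by (intro sum.cong) (auto simp: assms sum_distrib_left sum_distrib_right algebra_simps)
  also have "\<dots> = (\<Sum>i<p. \<Sum>t\<in>T. \<Sum>j<p. (l t i * w i) * (l t j * w j))"
    by (intro sum.cong refl sum.swap)
  also have "\<dots> = (\<Sum>t\<in>T. \<Sum>i<p. \<Sum>j<p. (l t i * w i) * (l t j * w j))"
    by (rule sum.swap)
  finally show ?thesis
    by (simp add: power2_eq_square sum_product)
qed

lemma psd_gramI:
  assumes "A \<in> carrier_mat p p"
    and "\<And>i j. i < p \<Longrightarrow> j < p \<Longrightarrow> A $$ (i, j) = (\<Sum>t\<in>T. l t i * l t j)"
  shows "psd p A"
  unfolding psd_iff_quad_form sym_mat_iff quad_form_gram[of p A, OF assms(2), simplified]
  using assms by (auto simp: mult.commute intro: sum_nonneg)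

text \<open>
  Through this decomposition positive semidefiniteness passes to Kronecker products and to the trace
  inner product without any spectral theory.
\<close>

lemma psd_gramE:
  assumes "psd p A"
  obtains N :: nat and l
  where "\<And>i j. i < p \<Longrightarrow> j < p \<Longrightarrow> A $$ (i, j) = (\<Sum>t<N. l t i * l t j)"
proof -
  have "\<exists>(N::nat) l. \<forall>i\<in>{..<p}. \<forall>j\<in>{..<p}. A $$ (i, j) = (\<Sum>t<N. l t i * l t j)"
    by (rule gram_decomposition)
      (use assms in \<open>auto simp: psd_iff_quad_form sym_mat_iff quad_form_def\<close>)
  then show ?thesis
    using that by auto
qed

lemma quad_form_smult_minus:
  assumes "A \<in> carrier_mat p p" "B \<in> carrier_mat p p"
  shows "quad_form p (c \<cdot>\<^sub>m A - B) w = c * quad_form p A w - quad_form p B w"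
  using assms by (simp add: quad_form_def sum_subtractf[symmetric] sum_distrib_left algebra_simps)

lemma sym_mat_smult_minus:
  assumes "sym_mat p A" "sym_mat p B"
  shows "sym_mat p (c \<cdot>\<^sub>m A - B)"
  using assms by (auto simp: sym_mat_iff)

lemma psd_smult: "psd p A \<Longrightarrow> 0 \<le> c \<Longrightarrow> psd p (c \<cdot>\<^sub>m A)"
  by (auto simp: psd_iff_quad_form sym_mat_iff quad_form_def mult.assoc simp flip: sum_distrib_left)

lemma psd_add: "psd p A \<Longrightarrow> psd p B \<Longrightarrow> psd p (A + B)"
  by (auto simp: psd_iff_quad_form sym_mat_iff quad_form_def distrib_right sum.distrib)

text \<open>
  Write both forms as sums of squares of functionals. The functionals of \<open>A\<close> vanish
  together only on the kernel of \<open>A\<close>, where the form of \<open>B\<close>, and with it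
  each functional of \<open>B\<close>, is zero by the inclusion of kernels. So every square in the
  form of \<open>B\<close> is bounded by a multiple of the form of \<open>A\<close>. Taking
  \<open>C\<close> at least \<open>1\<close> makes its powers increase with the exponent.
\<close>

lemma psd_dominated_if_kernel_subset:
  assumes A: "psd p A" and B: "psd p B" and ker: "mat_kernel A \<subseteq> mat_kernel B"
  shows "\<exists>C\<ge>1. psd p (C \<cdot>\<^sub>m A - B)"
proof -
  note carrier = psd_carrier[OF A] psd_carrier[OF B]
  obtain N :: nat and l where
    l: "\<And>i j. i < p \<Longrightarrow> j < p \<Longrightarrow> A $$ (i, j) = (\<Sum>t<N. l t i * l t j)"
    by (rule psd_gramE[OF A]) (rule that)
  obtain M :: nat and b where
    b: "\<And>i j. i < p \<Longrightarrow> j < p \<Longrightarrow> B $$ (i, j) = (\<Sum>s<M. b s i * b s j)"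
    by (rule psd_gramE[OF B]) (rule that)
  note qA = quad_form_gram[of p A, OF l, simplified] and qB = quad_form_gram[of p B, OF b, simplified]
  have vanish: "(\<Sum>i<p. b s i * w i) = 0"
    if s: "s < M" and w: "\<forall>t<N. (\<Sum>i<p. l t i * w i) = 0" for s w
  proof -
    have "(\<Sum>j<p. A $$ (i, j) * w j) = 0" if "i < p" for i
    proof -
      have "(\<Sum>j<p. A $$ (i, j) * w j) = (\<Sum>j<p. \<Sum>t<N. l t i * (l t j * w j))"
        using that by (intro sum.cong) (auto simp: l sum_distrib_right mult.assoc)
      also have "\<dots> = (\<Sum>t<N. l t i * (\<Sum>j<p. l t j * w j))"
        by (subst sum.swap) (simp add: sum_distrib_left)
      also have "\<dots> = 0"
        using w by simp
      finally show ?thesis .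
    qed
    then have "A *\<^sub>v vec p w = 0\<^sub>v p"
      using carrier by (intro eq_vecI) (auto simp: mult_mat_vec_vec_index simp del: index_mult_mat_vec)
    then have "vec p w \<in> mat_kernel B"
      using ker mat_kernelI[OF carrier(1) vec_carrier] by blast
    then have "quad_form p B w = 0"
      using mat_kernelD(2)[OF carrier(2)] scalar_prod_mult_mat_vec[OF carrier(2), of w]
      by simp
    then show ?thesis
      using s by (auto simp: qB sum_nonneg_eq_0_iff)
  qed
  have "\<forall>s<M. \<exists>C\<ge>0. \<forall>w. (\<Sum>i<p. b s i * w i)\<^sup>2 \<le> C * quad_form p A w"
    unfolding qA by (blast intro: functional_bounded_by_sum_of_squares vanish)
  then obtain C where C: "\<And>s. s < M \<Longrightarrow> 0 \<le> C s"
    "\<And>s w. s < M \<Longrightarrow> (\<Sum>i<p. b s i * w i)\<^sup>2 \<le> C s * quad_form p A w"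
    by metis
  define D where "D = 1 + (\<Sum>s<M. C s)"
  have "quad_form p B w \<le> D * quad_form p A w" for w
  proof -
    have "quad_form p B w \<le> (\<Sum>s<M. C s * quad_form p A w)"
      unfolding qB by (intro sum_mono C) auto
    also have "\<dots> = (\<Sum>s<M. C s) * quad_form p A w"
      by (simp add: sum_distrib_right)
    also have "\<dots> \<le> D * quad_form p A w"
      using quad_form_nonneg[OF A, of w] by (simp add: D_def distrib_right)
    finally show ?thesis .
  qed
  then have "psd p (D \<cdot>\<^sub>m A - B)"
    using A B carrier
    by (simp add: psd_iff_quad_form sym_mat_smult_minus quad_form_smult_minus)
  moreover have "1 \<le> D"
    using C(1) by (auto simp: D_def intro: sum_nonneg)
  ultimately show ?thesis
    by blast
qed

section \<open>Kronecker powers\<close>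

lemma kron_carrier:
  "A \<in> carrier_mat p p \<Longrightarrow> B \<in> carrier_mat r r \<Longrightarrow> kron A B \<in> carrier_mat (p * r) (p * r)"
  by (auto simp: kron_def)

lemma div_mod_less:
  fixes i p r :: nat
  assumes "i < p * r"
  shows "i div r < p" "i mod r < r"
  using assms by (simp add: less_mult_imp_div_less) (metis assms mod_less_divisor mult_0_right not_gr_zero not_less_zero)

lemma kron_index:
  assumes "A \<in> carrier_mat p p" "B \<in> carrier_mat r r" "i < p * r" "j < p * r"
  shows "kron A B $$ (i, j) = A $$ (i div r, j div r) * B $$ (i mod r, j mod r)"
  using assms by (auto simp: kron_def)

text \<open>
  The product of Gram sums is the Gram sum of the products
  \<open>l t (i div r) * b s (i mod r)\<close>.
\<close>

lemma psd_kron: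
  assumes A: "psd p A" and B: "psd r B"
  shows "psd (p * r) (kron A B)"
proof -
  note carrier = psd_carrier[OF A] psd_carrier[OF B]
  obtain N :: nat and l where
    l: "\<And>i j. i < p \<Longrightarrow> j < p \<Longrightarrow> A $$ (i, j) = (\<Sum>t<N. l t i * l t j)"
    by (rule psd_gramE[OF A]) (rule that)
  obtain M :: nat and b where
    b: "\<And>i j. i < r \<Longrightarrow> j < r \<Longrightarrow> B $$ (i, j) = (\<Sum>s<M. b s i * b s j)"
    by (rule psd_gramE[OF B]) (rule that)
  show ?thesis
  proof (rule psd_gramI[OF kron_carrier[OF carrier]])
    fix i j
    assume "i < p * r" "j < p * r"
    then show "kron A B $$ (i, j) = (\<Sum>ts\<in>{..<N} \<times> {..<M}.
        (case ts of (t, s) \<Rightarrow> \<lambda>i. l t (i div r) * b s (i mod r)) i *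
        (case ts of (t, s) \<Rightarrow> \<lambda>i. l t (i div r) * b s (i mod r)) j)"
      using div_mod_less[of i p r] div_mod_less[of j p r]
      by (auto simp: kron_index[OF carrier] l b sum_product sum.cartesian_product
          intro!: sum.cong)
  qed
qed

lemma kron_pow_carrier: "A \<in> carrier_mat p p \<Longrightarrow> kron_pow A k \<in> carrier_mat (p ^ k) (p ^ k)"
  by (induction k) (auto intro: kron_carrier)

lemma psd_kron_pow: "psd p A \<Longrightarrow> psd (p ^ k) (kron_pow A k)"
proof (induction k)
  case 0
  show ?case
    by (auto intro!: psd_gramI[where T = "{()}" and l = "\<lambda>_ _. 1"])
qed (simp add: psd_kron)

text \<open>
  The order survives Kronecker powers by telescoping: with \<open>A\<^sub>k\<close>,
  \<open>B\<^sub>k\<close> for the \<open>k\<close>-th powers,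
  \<open>C\<^sup>k\<^sup>+\<^sup>1 (A \<otimes> A\<^sub>k) - B \<otimes> B\<^sub>k = (C A - B) \<otimes> C\<^sup>k A\<^sub>k + B \<otimes> (C\<^sup>k A\<^sub>k - B\<^sub>k)\<close>,
  and both summands are Kronecker products of positive semidefinite matrices.
\<close>

lemma psd_kron_pow_mono:
  assumes A: "psd p A" and B: "psd p B" and dom: "psd p (C \<cdot>\<^sub>m A - B)" and C: "0 \<le> C"
  shows "psd (p ^ k) (C ^ k \<cdot>\<^sub>m kron_pow A k - kron_pow B k)"
proof (induction k)
  case 0
  show ?case
    by (rule psd_gramI[where T = "{}"]) auto
next
  case (Suc k)
  let ?A = "kron_pow A k" and ?B = "kron_pow B k"
  have cA: "A \<in> carrier_mat p p" and cB: "B \<in> carrier_mat p p"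
    using A B by (auto dest: psd_carrier)
  note cAk = kron_pow_carrier[OF cA, of k] and cBk = kron_pow_carrier[OF cB, of k]
  have "psd (p ^ Suc k)
      (kron (C \<cdot>\<^sub>m A - B) (C ^ k \<cdot>\<^sub>m ?A) + kron B (C ^ k \<cdot>\<^sub>m ?A - ?B))"
    using A B C dom Suc.IH by (simp add: psd_add psd_kron psd_smult psd_kron_pow)
  also have "kron (C \<cdot>\<^sub>m A - B) (C ^ k \<cdot>\<^sub>m ?A) + kron B (C ^ k \<cdot>\<^sub>m ?A - ?B)
      = C ^ Suc k \<cdot>\<^sub>m kron A ?A - kron B ?B" (is "?X + ?Y = ?Z")
  proof (rule eq_matI)
    have carriers: "?X \<in> carrier_mat (p * p ^ k) (p * p ^ k)" "?Y \<in> carrier_mat (p * p ^ k) (p * p ^ k)"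
        "kron A ?A \<in> carrier_mat (p * p ^ k) (p * p ^ k)" "kron B ?B \<in> carrier_mat (p * p ^ k) (p * p ^ k)"
      using cA cB cAk cBk by (auto intro!: kron_carrier)
    then show "dim_row (?X + ?Y) = dim_row ?Z" "dim_col (?X + ?Y) = dim_col ?Z"
      by auto
    fix i j
    assume "i < dim_row ?Z" "j < dim_col ?Z"
    then have ij: "i < p * p ^ k" "j < p * p ^ k"
      using carriers by auto
    note bounds = div_mod_less[OF ij(1)] div_mod_less[OF ij(2)]
    have "?X $$ (i, j) = (C * A $$ (i div p ^ k, j div p ^ k) - B $$ (i div p ^ k, j div p ^ k))
          * (C ^ k * ?A $$ (i mod p ^ k, j mod p ^ k))"
      using bounds cA cB cAk ij by (subst kron_index[where p = p and r = "p ^ k"]) auto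
    moreover have "?Y $$ (i, j) = B $$ (i div p ^ k, j div p ^ k)
          * (C ^ k * ?A $$ (i mod p ^ k, j mod p ^ k) - ?B $$ (i mod p ^ k, j mod p ^ k))"
      using bounds cB cAk cBk ij by (subst kron_index[where p = p and r = "p ^ k"]) auto
    ultimately show "(?X + ?Y) $$ (i, j) = ?Z $$ (i, j)"
      using ij carriers kron_index[OF cA cAk ij] kron_index[OF cB cBk ij]
      by (simp add: algebra_simps)
  qed
  finally show ?case
    by simp
qed

lemma mat_inner_eq_sum:
  assumes "A \<in> carrier_mat p p" "B \<in> carrier_mat p p"
  shows "mat_inner A B = (\<Sum>i<p. \<Sum>j<p. A $$ (j, i) * B $$ (j, i))"
  using assms by (auto simp: mat_inner_def scalar_prod_def atLeast0LessThan intro!: sum.cong)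

text \<open>
  If \<open>A\<close> is a sum of matrices \<open>l l\<^sup>T\<close>, the inner product is the sum
  of the values of the form of \<open>B\<close> at the vectors \<open>l\<close>.
\<close>

lemma mat_inner_psd_nonneg:
  assumes A: "psd p A" and B: "psd p B"
  shows "0 \<le> mat_inner A B"
proof -
  obtain N :: nat and l where
    l: "\<And>i j. i < p \<Longrightarrow> j < p \<Longrightarrow> A $$ (i, j) = (\<Sum>t<N. l t i * l t j)"
    by (rule psd_gramE[OF A]) (rule that)
  have "mat_inner A B = (\<Sum>i<p. \<Sum>j<p. \<Sum>t<N. B $$ (i, j) * l t i * l t j)"
    unfolding mat_inner_eq_sum[OF A[THEN psd_carrier] B[THEN psd_carrier]]
    by (subst sum.swap) (auto simp: l sum_distrib_right sum_distrib_left algebra_simps intro!: sum.cong)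
  also have "\<dots> = (\<Sum>i<p. \<Sum>t<N. \<Sum>j<p. B $$ (i, j) * l t i * l t j)"
    by (intro sum.cong refl sum.swap)
  also have "\<dots> = (\<Sum>t<N. quad_form p B (l t))"
    unfolding quad_form_def by (rule sum.swap)
  finally show ?thesis
    using B by (simp add: quad_form_nonneg sum_nonneg)
qed

lemma mat_inner_smult_minus:
  assumes "L \<in> carrier_mat p p" "A \<in> carrier_mat p p" "B \<in> carrier_mat p p"
  shows "mat_inner L (c \<cdot>\<^sub>m A - B) = c * mat_inner L A - mat_inner L (B :: real mat)"
proof -
  have "c \<cdot>\<^sub>m A - B \<in> carrier_mat p p"
    using assms by auto
  from mat_inner_eq_sum[OF assms(1) this] assms show ?thesis
    by (simp add: mat_inner_eq_sum[of _ p] sum_subtractf[symmetric] sum_distrib_left algebra_simps)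
qed

section \<open>Polynomials as functions\<close>

definition monom_val :: "('n \<Rightarrow>\<^sub>0 nat) \<Rightarrow> real ^ 'n \<Rightarrow> real" where
  "monom_val \<alpha> x = (\<Prod>i\<in>UNIV. vec_nth x i ^ Poly_Mapping.lookup \<alpha> i)"

lemma monom_val_add: "monom_val (\<alpha> + \<beta>) x = monom_val \<alpha> x * monom_val \<beta> x"
  by (simp add: monom_val_def lookup_add power_add prod.distrib)

lemma peval_superset:
  assumes "finite K" "Poly_Mapping.keys p \<subseteq> K"
  shows "peval p x = (\<Sum>\<alpha>\<in>K. Poly_Mapping.lookup p \<alpha> * monom_val \<alpha> x)"
  unfolding peval_def monom_val_def
  using assms by (intro sum.mono_neutral_left) (auto simp: in_keys_iff)

lemma peval_add: "peval (p + r) x = peval p x + peval r x"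
proof -
  let ?K = "Poly_Mapping.keys p \<union> Poly_Mapping.keys r"
  have "Poly_Mapping.keys (p + r) \<subseteq> ?K"
    by (rule keys_add)
  then show ?thesis
    by (simp add: peval_superset[where K = ?K] lookup_add distrib_right sum.distrib)
qed

lemma peval_zero: "peval 0 x = 0"
  by (simp add: peval_def)

lemma peval_uminus: "peval (- p) x = - peval p x"
  using peval_add[of "- p" p x] by (simp add: peval_zero)

lemma peval_diff: "peval (p - r) x = peval p x - peval r x"
  using peval_add[of p "- r" x] by (simp add: peval_uminus)

lemma peval_sum: "peval (sum g T) x = (\<Sum>t\<in>T. peval (g t) x)"
  by (induction T rule: infinite_finite_induct) (simp_all add: peval_zero peval_add)

lemma peval_single: "peval (Poly_Mapping.single \<alpha> c) x = c * monom_val \<alpha> x"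
  by (subst peval_superset[where K = "{\<alpha>}"]) auto

lemma peval_Const: "peval (Const c) x = c"
  by (simp add: Const_def peval_single monom_val_def)

lemma peval_one: "peval 1 x = 1"
  using peval_Const[of 1 x] by (simp add: Const_def)

lemma poly_eq_sum_singles:
  "p = (\<Sum>\<alpha>\<in>Poly_Mapping.keys p. Poly_Mapping.single \<alpha> (Poly_Mapping.lookup p \<alpha>))"
  by (rule poly_mapping_eqI)
    (auto simp: lookup_sum lookup_single when_def in_keys_iff)

lemma peval_mult: "peval (p * r) x = peval p x * peval r x"
proof -
  let ?m = "\<lambda>p \<alpha>. Poly_Mapping.single \<alpha> (Poly_Mapping.lookup p \<alpha>)"
  have "p * r = (\<Sum>\<alpha>\<in>Poly_Mapping.keys p. ?m p \<alpha>) * (\<Sum>\<beta>\<in>Poly_Mapping.keys r. ?m r \<beta>)"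
    using poly_eq_sum_singles[of p] poly_eq_sum_singles[of r] by simp
  then show ?thesis
    by (simp add: sum_product peval_sum mult_single peval_single monom_val_add
        peval_superset[where K = "Poly_Mapping.keys p"]
        peval_superset[where K = "Poly_Mapping.keys r"] algebra_simps)
qed

lemma tendsto_peval: "((\<lambda>x. peval p x) \<longlongrightarrow> peval p u) (nhds u)"
  unfolding peval_def by (intro tendsto_intros filterlim_ident)

text \<open>
  Induction on the variables. With all variables but \<open>v\<close> fixed in their sets, the sum
  is a univariate polynomial in the value of \<open>v\<close> with infinitely many roots, so its
  coefficients vanish; each of them is again such a sum, over the exponents with a given entry at
  \<open>v\<close>. Separation of \<open>K\<close> by the exponents at \<open>V\<close> is the
  hypothesis that this restriction preserves.
\<close>

lemma coefficients_zero_if_zero_on_box: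
  fixes c :: "'k \<Rightarrow> real" and e :: "'k \<Rightarrow> 'v \<Rightarrow> nat"
  assumes "finite V" "finite K"
    and "\<And>i. i \<in> V \<Longrightarrow> infinite (X i)"
    and "\<And>a b. a \<in> K \<Longrightarrow> b \<in> K \<Longrightarrow> (\<forall>i\<in>V. e a i = e b i) \<Longrightarrow> a = b"
    and "\<And>x. (\<forall>i\<in>V. x i \<in> X i) \<Longrightarrow> (\<Sum>a\<in>K. c a * (\<Prod>i\<in>V. x i ^ e a i)) = 0"
    and "a \<in> K"
  shows "c a = 0"
  using assms
proof (induction V arbitrary: K a rule: finite_induct)
  case empty
  then have "K = {a}"
    by auto
  then show ?case
    using empty.prems(4) by simp
next
  case (insert v V)
  define K' where "K' d = {b \<in> K. e b v = d}" for d
  define D where "D = Max ((\<lambda>b. e b v) ` K)"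
  have D: "e b v \<le> D" if "b \<in> K" for b
    using insert.prems(1) that by (auto simp: D_def)
  show ?case
  proof (rule insert.IH[of "K' (e a v)"])
    show "b = b'" if "b \<in> K' (e a v)" "b' \<in> K' (e a v)" "\<forall>i\<in>V. e b i = e b' i" for b b'
      using that insert.prems(3)[of b b'] by (auto simp: K'_def)
    fix x
    assume x: "\<forall>i\<in>V. x i \<in> X i"
    define g where "g d = (\<Sum>b\<in>K' d. c b * (\<Prod>i\<in>V. x i ^ e b i))" for d
    have "(\<Sum>d\<le>D. g d * t ^ d) = 0" if t: "t \<in> X v" for t
    proof -
      have "(\<Prod>i\<in>insert v V. (x(v := t)) i ^ e b i) = t ^ e b v * (\<Prod>i\<in>V. x i ^ e b i)" for b
      proof -
        have "(\<Prod>i\<in>V. (x(v := t)) i ^ e b i) = (\<Prod>i\<in>V. x i ^ e b i)"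
          using insert.hyps by (intro prod.cong) auto
        then show ?thesis
          using insert.hyps by simp
      qed
      moreover have "(\<Sum>b\<in>K. c b * (\<Prod>i\<in>insert v V. (x(v := t)) i ^ e b i)) = 0"
        using x t by (intro insert.prems(4)) auto
      ultimately have "0 = (\<Sum>b\<in>K. c b * (t ^ e b v * (\<Prod>i\<in>V. x i ^ e b i)))"
        by (simp del: fun_upd_apply)
      also have "\<dots> = (\<Sum>d\<le>D. \<Sum>b\<in>K' d. c b * (t ^ e b v * (\<Prod>i\<in>V. x i ^ e b i)))"
        unfolding K'_def using D insert.prems(1) by (intro sum.group[symmetric]) auto
      also have "\<dots> = (\<Sum>d\<le>D. g d * t ^ d)"
        unfolding g_def sum_distrib_right by (intro sum.cong) (auto simp: K'_def)
      finally show ?thesis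
        by simp
    qed
    then have "X v \<subseteq> {t. (\<Sum>d\<le>D. g d * t ^ d) = 0}"
      by blast
    then have "infinite {t. (\<Sum>d\<le>D. g d * t ^ d) = 0}"
      using insert.prems(2)[of v] infinite_super by blast
    then have "g (e a v) = 0"
      using polyfun_rootbound[of g "e a v" D] D[OF insert.prems(5)] by blast
    then show "(\<Sum>b\<in>K' (e a v). c b * (\<Prod>i\<in>V. x i ^ e b i)) = 0"
      by (simp add: g_def)
  qed (use insert.prems in \<open>auto simp: K'_def\<close>)
qed

text \<open>
  A neighbourhood contains a product of open subsets of the line, and these are infinite because a
  finite open subset of the line is empty. So all coefficients vanish, one for each exponent.
\<close>

lemma poly_eq_zero_if_zero_near:
  fixes p :: "'n::finite rpoly"
  assumes "\<forall>\<^sub>F x in nhds u. peval p x = 0"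
  shows "p = 0"
proof (rule poly_mapping_eqI)
  fix \<alpha>
  obtain X where X: "\<And>i. open (X i)" "\<And>i. u $ i \<in> X i"
    and zero: "\<And>x. (\<forall>i. x $ i \<in> X i) \<Longrightarrow> peval p x = 0"
    using assms unfolding eventually_nhds open_vec_def by metis
  have "Poly_Mapping.lookup p \<alpha> = 0" if "\<alpha> \<in> Poly_Mapping.keys p"
  proof (rule coefficients_zero_if_zero_on_box[where V = UNIV and K = "Poly_Mapping.keys p"
        and e = Poly_Mapping.lookup and X = X])
    show "infinite (X i)" for i
    proof
      assume "finite (X i)"
      \<comment> \<open>If \<open>X i\<close> were finite, removing all its other points would leave the singleton \<open>{u $ i}\<close> open.\<close>
      then have "open (X i - (X i - {u $ i}))"
        using X(1) by (intro open_Diff finite_imp_closed) auto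
      moreover have "X i - (X i - {u $ i}) = {u $ i}"
        using X(2)[of i] by auto
      ultimately show False
        using not_open_singleton by metis
    qed
    show "(\<Sum>\<beta>\<in>Poly_Mapping.keys p. Poly_Mapping.lookup p \<beta> *
        (\<Prod>i\<in>UNIV. x i ^ Poly_Mapping.lookup \<beta> i)) = 0" if "\<forall>i\<in>UNIV. x i \<in> X i" for x
      using zero[of "\<chi> i. x i"] that by (simp add: peval_def)
  qed (use that in \<open>auto intro: poly_mapping_eqI\<close>)
  then show "Poly_Mapping.lookup p \<alpha> = Poly_Mapping.lookup 0 \<alpha>"
    by (auto simp: in_keys_iff)
qed

section \<open>Growth of the members of the cone\<close>

lemma eval_mat_carrier: "G \<in> carrier_mat p r \<Longrightarrow> eval_mat G x \<in> carrier_mat p r"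
  by (simp add: eval_mat_def)

lemma eval_mat_index:
  "G \<in> carrier_mat p p \<Longrightarrow> i < p \<Longrightarrow> j < p \<Longrightarrow> eval_mat G x $$ (i, j) = peval (G $$ (i, j)) x"
  by (simp add: eval_mat_def)

lemma eval_mat_kron_pow:
  assumes "M \<in> carrier_mat p p"
  shows "eval_mat (kron_pow M k) x = kron_pow (eval_mat M x) k"
proof (induction k)
  case 0
  show ?case
    by (rule eq_matI) (auto simp: eval_mat_def peval_one)
next
  case (Suc k)
  have [simp]: "dim_row (kron_pow M k) = p ^ k" "dim_col (kron_pow M k) = p ^ k"
    "dim_row M = p" "dim_col M = p"
    using assms kron_pow_carrier[OF assms, of k] by auto
  have "eval_mat (kron M (kron_pow M k)) x = kron (eval_mat M x) (eval_mat (kron_pow M k) x)"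
    by (rule eq_matI) (auto simp: eval_mat_def kron_def peval_mult div_mod_less)
  then show ?case
    by (simp add: Suc.IH)
qed

lemma peval_mat_inner:
  fixes M :: "'n::finite rpoly mat"
  assumes L: "L \<in> carrier_mat p p" and M: "M \<in> carrier_mat p p"
  shows "peval (mat_inner (map_mat Const L) M) x = mat_inner L (eval_mat M x)"
proof -
  have "map_mat Const L \<in> carrier_mat p p"
    using L by simp
  from mat_inner_eq_sum[OF this M] show ?thesis
    using assms by (simp add: mat_inner_eq_sum[OF L eval_mat_carrier[OF M]] peval_sum peval_mult
        peval_Const eval_mat_index[OF M])
qed

lemma kron_coneE:
  fixes M :: "'n::finite rpoly mat"
  assumes h: "h \<in> kron_cone m p M" and M: "M \<in> carrier_mat p p"
  obtains l0 L where "0 \<le> l0" "\<And>k. k \<in> {1..m} \<Longrightarrow> psd (p ^ k) (L k)"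
    "\<And>x. peval h x = l0 + (\<Sum>k\<in>{1..m}. mat_inner (L k) (kron_pow (eval_mat M x) k))"
proof -
  obtain l0 L where "0 \<le> l0" and L: "\<And>k. k \<in> {1..m} \<Longrightarrow> psd (p ^ k) (L k)"
    and h: "h = Const l0 + (\<Sum>k\<in>{1..m}. mat_inner (map_mat Const (L k)) (kron_pow M k))"
    using h unfolding kron_cone_def by blast
  have "peval h x = l0 + (\<Sum>k\<in>{1..m}. mat_inner (L k) (kron_pow (eval_mat M x) k))" for x
    unfolding h peval_add peval_Const peval_sum
    using L by (auto simp: peval_mat_inner[OF psd_carrier kron_pow_carrier[OF M]]
        eval_mat_kron_pow[OF M] intro!: sum.cong)
  then show ?thesis
    using that \<open>0 \<le> l0\<close> L by blast
qed

lemma kron_cone_nonneg: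
  assumes h: "h \<in> kron_cone m p M" and M: "M \<in> carrier_mat p p"
    and x: "psd p (eval_mat M x)"
  shows "0 \<le> peval h x"
  by (rule kron_coneE[OF h M])
    (auto intro!: add_nonneg_nonneg sum_nonneg mat_inner_psd_nonneg psd_kron_pow x)

text \<open>
  Each term \<open>\<langle>L k, _\<rangle>\<close> respects the order of matrices, so its value
  at \<open>y\<close> is at most \<open>C ^ k\<close> times its value at \<open>x\<close>. The
  bound by \<open>C ^ m\<close> is the same for all members of the cone: this uniformity is what
  excludes exactness even when the supremum that defines the relaxation is not attained.
\<close>

lemma kron_cone_growth:
  fixes M :: "'n::finite rpoly mat"
  assumes h: "h \<in> kron_cone m p M" and M: "M \<in> carrier_mat p p"
    and x: "psd p (eval_mat M x)" and y: "psd p (eval_mat M y)"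
    and dom: "psd p (C \<cdot>\<^sub>m eval_mat M x - eval_mat M y)" and C: "1 \<le> C"
  shows "peval h y \<le> C ^ m * peval h x"
proof -
  let ?A = "eval_mat M x" and ?B = "eval_mat M y"
  obtain l0 L where l0: "0 \<le> l0" and L: "\<And>k. k \<in> {1..m} \<Longrightarrow> psd (p ^ k) (L k)"
    and h: "\<And>x. peval h x = l0 + (\<Sum>k\<in>{1..m}. mat_inner (L k) (kron_pow (eval_mat M x) k))"
    using kron_coneE[OF h M] by blast
  have "mat_inner (L k) (kron_pow ?B k) \<le> C ^ m * mat_inner (L k) (kron_pow ?A k)"
    if k: "k \<in> {1..m}" for k
  proof -
    note carriers = psd_carrier[OF L[OF k]] kron_pow_carrier[OF eval_mat_carrier[OF M]]
    have "0 \<le> mat_inner (L k) (C ^ k \<cdot>\<^sub>m kron_pow ?A k - kron_pow ?B k)"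
      using C by (intro mat_inner_psd_nonneg[OF L[OF k]] psd_kron_pow_mono x y dom) simp
    then have "mat_inner (L k) (kron_pow ?B k) \<le> C ^ k * mat_inner (L k) (kron_pow ?A k)"
      by (simp add: mat_inner_smult_minus[OF carriers carriers(2)])
    also have "\<dots> \<le> C ^ m * mat_inner (L k) (kron_pow ?A k)"
      using k C by (intro mult_right_mono power_increasing mat_inner_psd_nonneg[OF L[OF k]]
          psd_kron_pow x) auto
    finally show ?thesis .
  qed
  moreover have "l0 \<le> C ^ m * l0"
    using l0 C by (simp add: mult_le_cancel_right1)
  ultimately show ?thesis
    unfolding h distrib_left sum_distrib_left by (intro add_mono sum_mono) auto
qed

section \<open>Positive definite matrices\<close>

text \<open>
  Rearranging the hypothesis gives \<open>r \<le> a - (b - a) / D\<close>, a bound below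
  \<open>a\<close> that does not depend on \<open>r\<close>.
\<close>

lemma SUP_less_if_growth:
  fixes R :: "real set" and a b D :: real
  assumes "a < b" "1 \<le> D"
    and "\<And>r. r \<in> R \<Longrightarrow> r \<le> a"
    and "\<And>r. r \<in> R \<Longrightarrow> b - r \<le> D * (a - r)"
  shows "(SUP r\<in>R. ereal r) < ereal a"
proof -
  have "r \<le> a - (b - a) / D" if "r \<in> R" for r
  proof -
    have "b - a \<le> D * (a - r)"
      using assms(3,4)[OF that] by simp
    then show ?thesis
      using assms(2) by (simp add: field_simps)
  qed
  then have "(SUP r\<in>R. ereal r) \<le> ereal (a - (b - a) / D)"
    by (intro SUP_least) simp
  also have "\<dots> < ereal a"
    using assms(1,2) by simp
  finally show ?thesis .
qed

lemma pd_mat_kernel: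
  assumes "pd p A"
  shows "mat_kernel A \<subseteq> {0\<^sub>v p}"
proof
  fix v
  assume "v \<in> mat_kernel A"
  moreover have "A \<in> carrier_mat p p"
    using assms by (simp add: pd_def sym_mat_def)
  ultimately have v: "v \<in> carrier_vec p" "A *\<^sub>v v = 0\<^sub>v p"
    by (auto dest: mat_kernelD)
  then have "v \<bullet> (A *\<^sub>v v) = 0"
    by simp
  then show "v \<in> {0\<^sub>v p}"
    using assms v(1) by (auto simp: pd_def)
qed

lemma pd_mat_kernel_subset:
  assumes "pd p A" "B \<in> carrier_mat p p"
  shows "mat_kernel A \<subseteq> mat_kernel B"
proof -
  have "B *\<^sub>v 0\<^sub>v p = 0\<^sub>v p"
    using assms(2) by (intro eq_vecI) auto
  then show ?thesis
    using pd_mat_kernel[OF assms(1)] mat_kernelI[OF assms(2) zero_carrier_vec] by blast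
qed

lemma pd_imp_psd: "pd p A \<Longrightarrow> psd p A"
  unfolding pd_def psd_def by (metis carrier_vecD order_less_imp_le order_refl scalar_prod_left_zero
      sym_mat_def mult_mat_vec_carrier)

text \<open>
  The kernel of a positive definite matrix is that of the identity, so it dominates a multiple
  \<open>1 / C\<close> of the identity; a perturbation whose entries have absolute sum below
  \<open>1 / C\<close> cannot spoil positivity.
\<close>

lemma psd_if_close_to_pd:
  assumes A: "pd p A"
  shows "\<exists>\<epsilon>>0. \<forall>B. sym_mat p B \<longrightarrow> (\<Sum>i<p. \<Sum>j<p. \<bar>B $$ (i, j) - A $$ (i, j)\<bar>) < \<epsilon> \<longrightarrow> psd p B"
proof -
  have I: "psd p (1\<^sub>m p)"
    by (rule psd_gramI[where T = "{..<p}" and l = "\<lambda>t i. if i = t then 1 else 0"])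
      (auto simp: if_distrib cong: if_cong)
  have "mat_kernel A \<subseteq> mat_kernel (1\<^sub>m p)"
    by (rule pd_mat_kernel_subset[OF A]) simp
  from psd_dominated_if_kernel_subset[OF pd_imp_psd[OF A] I this]
  obtain C where C: "1 \<le> C" "psd p (C \<cdot>\<^sub>m A - 1\<^sub>m p)"
    by blast
  have cA: "A \<in> carrier_mat p p"
    using A by (simp add: pd_def sym_mat_def)
  have "psd p B" if B: "sym_mat p B"
    and close: "(\<Sum>i<p. \<Sum>j<p. \<bar>B $$ (i, j) - A $$ (i, j)\<bar>) < 1 / C" for B
  proof -
    have "0 \<le> quad_form p B w" for w
    proof -
      define n where "n = (\<Sum>i<p. (w i)\<^sup>2)"
      have n: "0 \<le> n"
        unfolding n_def by (intro sum_nonneg) simp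
      have single: "(w i)\<^sup>2 \<le> n" if "i < p" for i
        unfolding n_def using that by (intro member_le_sum) auto
      have prod: "\<bar>w i * w j\<bar> \<le> n" if "i < p" "j < p" for i j
      proof -
        have "2 * \<bar>w i * w j\<bar> \<le> (w i)\<^sup>2 + (w j)\<^sup>2"
          using zero_le_power2[of "\<bar>w i\<bar> - \<bar>w j\<bar>"] by (simp add: power2_diff abs_mult)
        then show ?thesis
          using single[OF that(1)] single[OF that(2)] by linarith
      qed
      have "quad_form p A w - quad_form p B w
          = (\<Sum>i<p. \<Sum>j<p. (A $$ (i, j) - B $$ (i, j)) * (w i * w j))"
        by (simp add: quad_form_def sum_subtractf[symmetric] algebra_simps)
      also have "\<dots> \<le> (\<Sum>i<p. \<Sum>j<p. \<bar>B $$ (i, j) - A $$ (i, j)\<bar> * n)"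
      proof (intro sum_mono)
        fix i j
        assume "i \<in> {..<p}" "j \<in> {..<p}"
        have "(A $$ (i, j) - B $$ (i, j)) * (w i * w j)
            \<le> \<bar>A $$ (i, j) - B $$ (i, j)\<bar> * \<bar>w i * w j\<bar>"
          by (metis abs_ge_self abs_mult)
        also have "\<dots> \<le> \<bar>B $$ (i, j) - A $$ (i, j)\<bar> * n"
          using prod \<open>i \<in> {..<p}\<close> \<open>j \<in> {..<p}\<close> by (simp add: abs_minus_commute mult_left_mono)
        finally show "(A $$ (i, j) - B $$ (i, j)) * (w i * w j) \<le> \<bar>B $$ (i, j) - A $$ (i, j)\<bar> * n" .
      qed
      also have "\<dots> \<le> 1 / C * n"
        unfolding sum_distrib_right[symmetric] using close n by (intro mult_right_mono) auto
      \<comment> \<open>\<open>n\<close> is the form of the identity matrix, which \<open>C \<cdot>\<^sub>m A\<close> dominates.\<close>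
      also have "\<dots> \<le> quad_form p A w"
      proof -
        have "quad_form p (1\<^sub>m p) w = n"
          by (simp add: quad_form_def n_def power2_eq_square if_distrib[of "\<lambda>c. c * _"] cong: if_cong)
        then have "0 \<le> C * quad_form p A w - n"
          using quad_form_nonneg[OF C(2), of w] cA by (simp add: quad_form_smult_minus)
        then show ?thesis
          using C(1) by (simp add: field_simps)
      qed
      finally show ?thesis
        by simp
    qed
    then show ?thesis
      using B by (simp add: psd_iff_quad_form)
  qed
  then show ?thesis
    using C(1) by (intro exI[of _ "1 / C"]) auto
qed

lemma sym_mat_eval: "sym_mat q G \<Longrightarrow> sym_mat q (eval_mat G x)"
  by (auto simp: sym_mat_iff eval_mat_index eval_mat_carrier sym_mat_def mat_eq_iff)

lemma eventually_feasible_near_pd: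
  assumes G: "sym_mat q G" and pd: "pd q (eval_mat G u)"
  shows "\<forall>\<^sub>F x in nhds u. x \<in> feasible q G"
proof -
  have carrier: "G \<in> carrier_mat q q"
    using G by (simp add: sym_mat_def)
  obtain \<epsilon> where \<epsilon>: "\<epsilon> > 0" "\<And>B. sym_mat q B \<Longrightarrow>
      (\<Sum>i<q. \<Sum>j<q. \<bar>B $$ (i, j) - eval_mat G u $$ (i, j)\<bar>) < \<epsilon> \<Longrightarrow> psd q B"
    using psd_if_close_to_pd[OF pd] by blast
  have "((\<lambda>x. \<Sum>i<q. \<Sum>j<q. \<bar>peval (G $$ (i, j)) x - peval (G $$ (i, j)) u\<bar>) \<longlongrightarrow>
      (\<Sum>i<q. \<Sum>j<q. \<bar>peval (G $$ (i, j)) u - peval (G $$ (i, j)) u\<bar>)) (nhds u)"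
    by (intro tendsto_intros tendsto_peval)
  then have "\<forall>\<^sub>F x in nhds u. (\<Sum>i<q. \<Sum>j<q. \<bar>peval (G $$ (i, j)) x - peval (G $$ (i, j)) u\<bar>) < \<epsilon>"
    using \<epsilon>(1) by (intro order_tendstoD(2)) auto
  then show ?thesis
  proof eventually_elim
    case (elim x)
    then show ?case
      unfolding feasible_def
      by (auto intro!: \<epsilon>(2) sym_mat_eval G simp: eval_mat_index[OF carrier])
  qed
qed

section \<open>Block diagonal matrices\<close>

lemma tilde_carrier: "G \<in> carrier_mat q q \<Longrightarrow> tilde q G \<in> carrier_mat (2 * q) (2 * q)"
  unfolding tilde_def mult_2 by (intro four_block_carrier_mat) auto

lemma eval_mat_tilde:
  assumes "G \<in> carrier_mat q q"
  shows "eval_mat (tilde q G) x =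
    four_block_mat (eval_mat G x) (0\<^sub>m q q) (0\<^sub>m q q) (1\<^sub>m q - eval_mat G x)"
  using assms
  by (intro eq_matI) (auto simp: tilde_def eval_mat_def peval_zero peval_diff peval_one)

lemma four_block_diag_form:
  fixes A B :: "real mat"
  assumes A: "A \<in> carrier_mat q q" and B: "B \<in> carrier_mat q q" and v: "v \<in> carrier_vec (2 * q)"
  obtains a b where "a \<in> carrier_vec q" "b \<in> carrier_vec q" "v = a @\<^sub>v b"
    "v \<bullet> (four_block_mat A (0\<^sub>m q q) (0\<^sub>m q q) B *\<^sub>v v) = a \<bullet> (A *\<^sub>v a) + b \<bullet> (B *\<^sub>v b)"
proof -
  have ab: "vec_first v q \<in> carrier_vec q" "vec_last v q \<in> carrier_vec q" "v = vec_first v q @\<^sub>v vec_last v q"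
    using v by (auto simp: mult_2)
  have "v \<bullet> (four_block_mat A (0\<^sub>m q q) (0\<^sub>m q q) B *\<^sub>v v)
      = vec_first v q \<bullet> (A *\<^sub>v vec_first v q) + vec_last v q \<bullet> (B *\<^sub>v vec_last v q)"
    using A B ab(1,2) by (subst ab(3), subst (2) ab(3))
      (simp add: mult_mat_vec_split[OF A B] scalar_prod_append[of _ q _ q])
  then show ?thesis
    using that ab by blast
qed

lemma sym_mat_four_block_diag:
  assumes "sym_mat q A" "sym_mat q B"
  shows "sym_mat (2 * q) (four_block_mat A (0\<^sub>m q q) (0\<^sub>m q q) B)"
  using assms unfolding sym_mat_iff by auto

lemma psd_four_block_diag:
  assumes A: "psd q A" and B: "psd q B"
  shows "psd (2 * q) (four_block_mat A (0\<^sub>m q q) (0\<^sub>m q q) B)"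
  unfolding psd_def
proof (intro conjI ballI)
  fix v :: "real vec"
  assume v: "v \<in> carrier_vec (2 * q)"
  show "0 \<le> v \<bullet> (four_block_mat A (0\<^sub>m q q) (0\<^sub>m q q) B *\<^sub>v v)"
    using A B by (auto intro: four_block_diag_form[OF psd_carrier[OF A] psd_carrier[OF B] v]
        simp: psd_def)
qed (use assms in \<open>simp add: psd_sym sym_mat_four_block_diag\<close>)

lemma pd_four_block_diag:
  assumes A: "pd q A" and B: "pd q B"
  shows "pd (2 * q) (four_block_mat A (0\<^sub>m q q) (0\<^sub>m q q) B)"
  unfolding pd_def
proof (intro conjI ballI impI)
  fix v :: "real vec"
  assume v: "v \<in> carrier_vec (2 * q)" and nz: "v \<noteq> 0\<^sub>v (2 * q)"
  note psd = pd_imp_psd[OF A] pd_imp_psd[OF B]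
  obtain a b where ab: "a \<in> carrier_vec q" "b \<in> carrier_vec q" and "v = a @\<^sub>v b"
    and form: "v \<bullet> (four_block_mat A (0\<^sub>m q q) (0\<^sub>m q q) B *\<^sub>v v) = a \<bullet> (A *\<^sub>v a) + b \<bullet> (B *\<^sub>v b)"
    by (rule four_block_diag_form[OF psd_carrier psd_carrier v, OF psd])
  then have "a \<noteq> 0\<^sub>v q \<or> b \<noteq> 0\<^sub>v q"
    using nz by (auto simp: mult_2)
  moreover have "0 \<le> a \<bullet> (A *\<^sub>v a)" "0 \<le> b \<bullet> (B *\<^sub>v b)"
    using psd ab by (auto simp: psd_def)
  moreover have "a \<noteq> 0\<^sub>v q \<Longrightarrow> 0 < a \<bullet> (A *\<^sub>v a)" "b \<noteq> 0\<^sub>v q \<Longrightarrow> 0 < b \<bullet> (B *\<^sub>v b)"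
    using A B ab by (auto simp: pd_def)
  ultimately show "0 < v \<bullet> (four_block_mat A (0\<^sub>m q q) (0\<^sub>m q q) B *\<^sub>v v)"
    unfolding form by linarith
qed (use assms in \<open>simp add: pd_def sym_mat_four_block_diag\<close>)

section \<open>Inexactness of the relaxations\<close>

text \<open>
  The matrix whose Kronecker powers generate the hierarchy, and its size, so that the linear and the
  nonlinear case share one argument.
\<close>

definition defining_mat :: "nat \<Rightarrow> 'n::finite rpoly mat \<Rightarrow> 'n rpoly mat" where
  "defining_mat q G = (if linear_pmat q G then G else tilde q G)"

definition defining_dim :: "nat \<Rightarrow> 'n::finite rpoly mat \<Rightarrow> nat" where
  "defining_dim q G = (if linear_pmat q G then q else 2 * q)"

lemma hierarchy_eq_kron_cone: "hierarchy q m G = kron_cone m (defining_dim q G) (defining_mat q G)"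
  by (simp add: hierarchy_def defining_mat_def defining_dim_def)

lemma defining_mat_carrier:
  "G \<in> carrier_mat q q \<Longrightarrow> defining_mat q G \<in> carrier_mat (defining_dim q G) (defining_dim q G)"
  by (simp add: defining_mat_def defining_dim_def tilde_carrier)

lemma psd_defining_mat:
  assumes "G \<in> carrier_mat q q" "psd q (eval_mat G x)"
    and "\<not> linear_pmat q G \<Longrightarrow> psd q (1\<^sub>m q - eval_mat G x)"
  shows "psd (defining_dim q G) (eval_mat (defining_mat q G) x)"
  using assms by (simp add: defining_mat_def defining_dim_def eval_mat_tilde psd_four_block_diag)

lemma pd_defining_mat:
  assumes "G \<in> carrier_mat q q" "pd q (eval_mat G x)"
    and "\<not> linear_pmat q G \<Longrightarrow> pd q (1\<^sub>m q - eval_mat G x)"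
  shows "pd (defining_dim q G) (eval_mat (defining_mat q G) x)"
  using assms by (simp add: defining_mat_def defining_dim_def eval_mat_tilde pd_four_block_diag)

lemma opt_value_minimizer:
  assumes "is_arg_min (peval f) (\<lambda>x. x \<in> feasible q G) u"
  shows "opt_value q f G = ereal (peval f u)"
  unfolding opt_value_def
  using assms by (intro antisym INF_lower INF_greatest) (auto simp: is_arg_min_linorder)

lemma relax_value_less:
  fixes f :: "'n::finite rpoly"
  assumes G: "G \<in> carrier_mat q q"
    and x: "psd (defining_dim q G) (eval_mat (defining_mat q G) x)"
    and y: "psd (defining_dim q G) (eval_mat (defining_mat q G) y)"
    and ker: "mat_kernel (eval_mat (defining_mat q G) x) \<subseteq> mat_kernel (eval_mat (defining_mat q G) y)"
    and less: "peval f x < peval f y"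
  shows "relax_value q m f G < ereal (peval f x)"
proof -
  obtain C where C: "1 \<le> C"
    "psd (defining_dim q G) (C \<cdot>\<^sub>m eval_mat (defining_mat q G) x - eval_mat (defining_mat q G) y)"
    using psd_dominated_if_kernel_subset[OF x y ker] by blast
  show ?thesis
    unfolding relax_value_def hierarchy_eq_kron_cone
  proof (rule SUP_less_if_growth[OF less])
    show "1 \<le> C ^ m"
      using C(1) by simp
    fix r
    assume "r \<in> {r. f - Const r \<in> kron_cone m (defining_dim q G) (defining_mat q G)}"
    then have r: "f - Const r \<in> kron_cone m (defining_dim q G) (defining_mat q G)"
      by simp
    show "r \<le> peval f x"
      using kron_cone_nonneg[OF r defining_mat_carrier[OF G] x] by (simp add: peval_diff peval_Const)
    show "peval f y - r \<le> C ^ m * (peval f x - r)"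
      using kron_cone_growth[OF r defining_mat_carrier[OF G] x y C(2,1)]
      by (simp add: peval_diff peval_Const)
  qed
qed

text \<open>
  The minimizer is an interior point of the feasible set. If all feasible points were optimal,
  \<open>f\<close> would equal its minimum on a neighbourhood, and thus be that constant as a
  polynomial.
\<close>

lemma nonoptimal_point_near_pd_minimizer:
  fixes f :: "'n::finite rpoly"
  assumes G: "sym_mat q G"
    and min: "is_arg_min (peval f) (\<lambda>x. x \<in> feasible q G) u"
    and pd: "pd q (eval_mat G u)"
    and nonconst: "\<nexists>c. f = Const c"
  obtains y where "y \<in> feasible q G" "peval f u < peval f y"
proof -
  have "\<exists>y\<in>feasible q G. peval f u < peval f y"
  proof (rule ccontr)
    assume "\<not> ?thesis"
    then have "peval f y = peval f u" if "y \<in> feasible q G" for y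
      using min that by (force simp: is_arg_min_linorder)
    then have "\<forall>\<^sub>F x in nhds u. peval (f - Const (peval f u)) x = 0"
      using eventually_feasible_near_pd[OF G pd]
      by (auto simp: peval_diff peval_Const elim: eventually_mono)
    then have "f - Const (peval f u) = 0"
      by (rule poly_eq_zero_if_zero_near)
    then show False
      using nonconst by auto
  qed
  then show ?thesis
    using that by blast
qed

theorem proposition4p5:
  fixes f :: "'n::finite rpoly" and G :: "'n rpoly mat" and q :: nat and u_star :: "real ^ 'n"
  assumes symm: "sym_mat q G"
    and minimizer: "is_arg_min (peval f) (\<lambda>x. x \<in> feasible q G) u_star"
    and bounded: "\<not> linear_pmat q G \<Longrightarrow> \<forall>x\<in>feasible q G. psd q (1\<^sub>m q - eval_mat G x)"
  shows
    "((\<exists>u\<in>feasible q G. peval f u > opt_value q f G \<and>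
        (if linear_pmat q G
         then mat_kernel (eval_mat G u_star) \<subseteq> mat_kernel (eval_mat G u)
         else mat_kernel (eval_mat (tilde q G) u_star) \<subseteq> mat_kernel (eval_mat (tilde q G) u)))
      \<longrightarrow> (\<forall>m. relax_value q m f G \<noteq> opt_value q f G))
     \<and>
     ((\<nexists>c. f = Const c) \<and> pd q (eval_mat G u_star) \<and>
        (\<not> linear_pmat q G \<longrightarrow> pd q (1\<^sub>m q - eval_mat G u_star))
      \<longrightarrow> (\<forall>m. relax_value q m f G \<noteq> opt_value q f G))"
proof -
  have G: "G \<in> carrier_mat q q"
    using symm by (simp add: sym_mat_def)
  note opt = opt_value_minimizer[OF minimizer]
  have psd: "psd (defining_dim q G) (eval_mat (defining_mat q G) x)" if "x \<in> feasible q G" for x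
    using that bounded by (intro psd_defining_mat[OF G]) (auto simp: feasible_def)
  have u_star: "u_star \<in> feasible q G"
    using minimizer by (simp add: is_arg_min_def)
  have inexact: "relax_value q m f G \<noteq> opt_value q f G"
    if u: "u \<in> feasible q G" "peval f u_star < peval f u"
      and ker: "mat_kernel (eval_mat (defining_mat q G) u_star) \<subseteq> mat_kernel (eval_mat (defining_mat q G) u)"
    for u m
    using relax_value_less[OF G psd[OF u_star] psd[OF u(1)] ker u(2), of m] by (simp add: opt)
  show ?thesis
  proof (intro conjI impI allI)
    fix m
    assume "\<exists>u\<in>feasible q G. peval f u > opt_value q f G \<and>
        (if linear_pmat q G
         then mat_kernel (eval_mat G u_star) \<subseteq> mat_kernel (eval_mat G u)
         else mat_kernel (eval_mat (tilde q G) u_star) \<subseteq> mat_kernel (eval_mat (tilde q G) u))"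
    then show "relax_value q m f G \<noteq> opt_value q f G"
      using inexact by (auto simp: opt defining_mat_def split: if_splits)
  next
    fix m
    assume asm: "(\<nexists>c. f = Const c) \<and> pd q (eval_mat G u_star) \<and>
        (\<not> linear_pmat q G \<longrightarrow> pd q (1\<^sub>m q - eval_mat G u_star))"
    then obtain u where u: "u \<in> feasible q G" "peval f u_star < peval f u"
      using nonoptimal_point_near_pd_minimizer[OF symm minimizer] by blast
    have "pd (defining_dim q G) (eval_mat (defining_mat q G) u_star)"
      using asm by (intro pd_defining_mat[OF G]) auto
    then show "relax_value q m f G \<noteq> opt_value q f G"
      by (intro inexact[OF u] pd_mat_kernel_subset[OF _ psd_carrier[OF psd[OF u(1)]]])
  qed
qed

end
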